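(* Let $(A,\exists,\forall)$ be a monadic distributive commutative pseudo BE-algebra. Then there is a one-to-one correspondence between $\mathcal{MCON}(A,\exists,\forall)$, the set of all monadic congruence relations on $(A,\exists,\forall)$, and $\mathcal{MDS}(A,\exists,\forall)$, the set of all monadic deductive systems of $(A,\exists,\forall)$.
   Context: A pseudo BE-algebra is an algebra $(A,\to,\rightsquigarrow,1)$ of type $(2,2,0)$ such that for all $x,y,z\in A$: $x\to x=x\rightsquigarrow x=1$; $x\to 1=x\rightsquigarrow 1=1$; $1\to x=1\rightsquigarrow x=x$; $x\to(y\rightsquigarrow z)=y\rightsquigarrow(x\to z)$; and $x\to y=1$ iff $x\rightsquigarrow y=1$. It is commutative if $(x\to y)\rightsquigarrow y=(y\to x)\rightsquigarrow x$ and $(x\rightsquigarrow y)\to y=(y\rightsquigarrow x)\to x$ for all $x,y\in A$. It is distributive if $x\to(y\rightsquigarrow z)=(x\to y)\rightsquigarrow(x\to z)$ for all $x,y,z\in A$. A monadic pseudo BE-algebra $(A,\exists,\forall)$ is a pseudo BE-algebra $A$ with maps $\exists,\forall:A\to A$ such that for all $x,y\in A$: (M1) $x\to\exists x=x\rightsquigarrow\exists x=1$; (M2) $\forall x\to x=\forall x\rightsquigarrow x=1$; (M3) $\forall(x\to\exists y)=\exists x\to\exists y$ and $\forall(x\rightsquigarrow\exists y)=\exists x\rightsquigarrow\exists y$; (M4) $\forall(\exists x\to y)=\exists x\to\forall y$ and $\forall(\exists x\rightsquigarrow y)=\exists x\rightsquigarrow\forall y$; (M5) $\exists\forall x=\forall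 x$. It is called distributive commutative if its underlying pseudo BE-algebra is distributive and commutative. A deductive system of $A$ is a subset $D\subseteq A$ with $1\in D$ such that, for all $x,y\in A$, $x\in D$ and $x\to y\in D$ imply $y\in D$. A deductive system $D$ is monadic if $x\in D$ implies $\forall x\in D$. A congruence relation on $A$ is an equivalence relation $\Theta$ on $A$ such that $(x,y),(u,v)\in\Theta$ imply $(x\to u,y\to v),(x\rightsquigarrow u,y\rightsquigarrow v)\in\Theta$. A congruence relation $\Theta$ is monadic if $(x,y)\in\Theta$ implies $(\forall x,\forall y)\in\Theta$ for all $x,y\in A$. *)

theory Defs
  imports Main
begin

locale pseudo_BE_algebra =
  fixes A :: "'a set"
    and imp :: "'a \<Rightarrow> 'a \<Rightarrow> 'a"  (infixr "\<rightarrow>" 60)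
    and rimp :: "'a \<Rightarrow> 'a \<Rightarrow> 'a"  (infixr "\<leadsto>" 60)
    and one :: 'a  ("\<one>")
  assumes imp_closed: "\<lbrakk>x \<in> A; y \<in> A\<rbrakk> \<Longrightarrow> x \<rightarrow> y \<in> A"
    and rimp_closed: "\<lbrakk>x \<in> A; y \<in> A\<rbrakk> \<Longrightarrow> x \<leadsto> y \<in> A"
    and one_closed: "\<one> \<in> A"
    and imp_self: "x \<in> A \<Longrightarrow> x \<rightarrow> x = \<one>"
    and rimp_self: "x \<in> A \<Longrightarrow> x \<leadsto> x = \<one>"
    and imp_one: "x \<in> A \<Longrightarrow> x \<rightarrow> \<one> = \<one>"
    and rimp_one: "x \<in> A \<Longrightarrow> x \<leadsto> \<one> = \<one>"
    and one_imp: "x \<in> A \<Longrightarrow> \<one> \<rightarrow> x = x"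
    and one_rimp: "x \<in> A \<Longrightarrow> \<one> \<leadsto> x = x"
    and exchange: "\<lbrakk>x \<in> A; y \<in> A; z \<in> A\<rbrakk> \<Longrightarrow> x \<rightarrow> (y \<leadsto> z) = y \<leadsto> (x \<rightarrow> z)"
    and imp_eq_one_iff: "\<lbrakk>x \<in> A; y \<in> A\<rbrakk> \<Longrightarrow> x \<rightarrow> y = \<one> \<longleftrightarrow> x \<leadsto> y = \<one>"

locale commutative_pseudo_BE_algebra = pseudo_BE_algebra +
  assumes comm_imp: "\<lbrakk>x \<in> A; y \<in> A\<rbrakk> \<Longrightarrow> (x \<rightarrow> y) \<leadsto> y = (y \<rightarrow> x) \<leadsto> x"
    and comm_rimp: "\<lbrakk>x \<in> A; y \<in> A\<rbrakk> \<Longrightarrow> (x \<leadsto> y) \<rightarrow> y = (y \<leadsto> x) \<rightarrow> x"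

locale distributive_pseudo_BE_algebra = pseudo_BE_algebra +
  assumes distrib: "\<lbrakk>x \<in> A; y \<in> A; z \<in> A\<rbrakk> \<Longrightarrow> x \<rightarrow> (y \<leadsto> z) = (x \<rightarrow> y) \<leadsto> (x \<rightarrow> z)"

locale monadic_pseudo_BE_algebra = pseudo_BE_algebra +
  fixes E :: "'a \<Rightarrow> 'a"  \<comment> \<open>the operator written \<open>\<exists>\<close> on paper\<close>
    and U :: "'a \<Rightarrow> 'a"  \<comment> \<open>the operator written \<open>\<forall>\<close> on paper\<close>
  assumes E_closed: "x \<in> A \<Longrightarrow> E x \<in> A"
    and U_closed: "x \<in> A \<Longrightarrow> U x \<in> A"
    and M1_imp: "x \<in> A \<Longrightarrow> x \<rightarrow> E x = \<one>"
    and M1_rimp: "x \<in> A \<Longrightarrow> x \<leadsto> E x = \<one>"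
    and M2_imp: "x \<in> A \<Longrightarrow> U x \<rightarrow> x = \<one>"
    and M2_rimp: "x \<in> A \<Longrightarrow> U x \<leadsto> x = \<one>"
    and M3_imp: "\<lbrakk>x \<in> A; y \<in> A\<rbrakk> \<Longrightarrow> U (x \<rightarrow> E y) = E x \<rightarrow> E y"
    and M3_rimp: "\<lbrakk>x \<in> A; y \<in> A\<rbrakk> \<Longrightarrow> U (x \<leadsto> E y) = E x \<leadsto> E y"
    and M4_imp: "\<lbrakk>x \<in> A; y \<in> A\<rbrakk> \<Longrightarrow> U (E x \<rightarrow> y) = E x \<rightarrow> U y"
    and M4_rimp: "\<lbrakk>x \<in> A; y \<in> A\<rbrakk> \<Longrightarrow> U (E x \<leadsto> y) = E x \<leadsto> U y"
    and M5: "x \<in> A \<Longrightarrow> E (U x) = U x"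

locale monadic_distributive_commutative_pseudo_BE_algebra =
  monadic_pseudo_BE_algebra + distributive_pseudo_BE_algebra + commutative_pseudo_BE_algebra

definition deductive_system :: "'a set \<Rightarrow> ('a \<Rightarrow> 'a \<Rightarrow> 'a) \<Rightarrow> 'a \<Rightarrow> 'a set \<Rightarrow> bool" where
  "deductive_system A imp one D \<longleftrightarrow>
     D \<subseteq> A \<and> one \<in> D \<and> (\<forall>x\<in>A. \<forall>y\<in>A. x \<in> D \<longrightarrow> imp x y \<in> D \<longrightarrow> y \<in> D)"

definition monadic_deductive_systems ::
    "'a set \<Rightarrow> ('a \<Rightarrow> 'a \<Rightarrow> 'a) \<Rightarrow> 'a \<Rightarrow> ('a \<Rightarrow> 'a) \<Rightarrow> 'a set set" where
  "monadic_deductive_systems A imp one U =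
     {D. deductive_system A imp one D \<and> (\<forall>x\<in>D. U x \<in> D)}"

definition congruence ::
    "'a set \<Rightarrow> ('a \<Rightarrow> 'a \<Rightarrow> 'a) \<Rightarrow> ('a \<Rightarrow> 'a \<Rightarrow> 'a) \<Rightarrow> 'a rel \<Rightarrow> bool" where
  "congruence A imp rimp \<Theta> \<longleftrightarrow>
     equiv A \<Theta> \<and>
     (\<forall>x y u v. (x, y) \<in> \<Theta> \<longrightarrow> (u, v) \<in> \<Theta> \<longrightarrow>
        (imp x u, imp y v) \<in> \<Theta> \<and> (rimp x u, rimp y v) \<in> \<Theta>)"

definition monadic_congruences ::
    "'a set \<Rightarrow> ('a \<Rightarrow> 'a \<Rightarrow> 'a) \<Rightarrow> ('a \<Rightarrow> 'a \<Rightarrow> 'a) \<Rightarrow> ('a \<Rightarrow> 'a) \<Rightarrow> 'a rel set" where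
  "monadic_congruences A imp rimp U =
     {\<Theta>. congruence A imp rimp \<Theta> \<and> (\<forall>x y. (x, y) \<in> \<Theta> \<longrightarrow> (U x, U y) \<in> \<Theta>)}"

end

theory Submission
  imports Defs
begin

text \<open>
  As for groups and normal subgroups, a congruence is determined by the class of \<open>\<one>\<close>, and the
  classes that occur are exactly the monadic deductive systems. The correspondence sends \<open>\<Theta>\<close> to
  \<open>\<Theta> `` {\<one>}\<close>; its inverse sends \<open>D\<close> to the relation \<open>x \<rightarrow> y \<in> D \<and> y \<rightarrow> x \<in> D\<close>.

  Commutativity makes a congruence recoverable from the class of \<open>\<one>\<close>: if \<open>x \<rightarrow> y\<close> and \<open>y \<rightarrow> x\<close> are
  both congruent to \<open>\<one>\<close>, then \<open>y = \<one> \<leadsto> y\<close> is congruent to \<open>(x \<rightarrow> y) \<leadsto> y = (y \<rightarrow> x) \<leadsto> x\<close>, and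
  this is congruent to \<open>\<one> \<leadsto> x = x\<close>.

  That the relation defined by \<open>D\<close> respects both implications would be awkward to show directly,
  because deductive systems are closed under modus ponens for \<open>\<rightarrow>\<close> only and distributivity
  treats the two implications differently. The difficulty disappears because distributivity and
  commutativity together force \<open>\<rightarrow>\<close> and \<open>\<leadsto>\<close> to coincide (\<open>rimp_eq_imp\<close>). The algebra then has a
  single self-distributive implication, as in a Hilbert algebra, and compatibility follows from the
  transitivity laws \<open>x \<rightarrow> y \<le> (y \<rightarrow> u) \<rightarrow> (x \<rightarrow> u)\<close> and \<open>u \<rightarrow> v \<le> (x \<rightarrow> u) \<rightarrow> (x \<rightarrow> v)\<close>, where
  \<open>a \<le> b\<close> stands for \<open>a \<rightarrow> b = \<one>\<close>.

  The quantifiers enter through the identity \<open>U (U x \<rightarrow> y) = U x \<rightarrow> U y\<close>, which carries closure of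
  \<open>D\<close> under the universal quantifier \<open>U\<close> over to the relation it defines.
\<close>

section \<open>The order of a commutative pseudo BE-algebra\<close>

context pseudo_BE_algebra
begin

lemma le_imp:
  assumes "x \<in> A" "y \<in> A"
  shows "y \<rightarrow> (x \<rightarrow> y) = \<one>"
proof -
  have "y \<leadsto> (x \<rightarrow> y) = \<one>"
    using assms exchange[of x y y] by (simp add: rimp_self imp_one)
  then show ?thesis
    using assms imp_eq_one_iff by (simp add: imp_closed)
qed

text \<open>The exchange law turns \<open>a \<le> b \<leadsto> c\<close> into \<open>b \<le> a \<rightarrow> c\<close>: the two implications form a
  Galois connection, which is what relates them to each other.\<close>

lemma le_rimp_iff_le_imp:
  assumes "a \<in> A" "b \<in> A" "c \<in> A"
  shows "a \<rightarrow> (b \<leadsto> c) = \<one> \<longleftrightarrow> b \<rightarrow> (a \<rightarrow> c) = \<one>"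
  using assms by (simp add: exchange imp_eq_one_iff imp_closed)

lemma le_imp_rimp:
  assumes "x \<in> A" "y \<in> A"
  shows "x \<rightarrow> ((x \<rightarrow> y) \<leadsto> y) = \<one>"
  using assms by (simp add: le_rimp_iff_le_imp imp_closed imp_self)

end

context commutative_pseudo_BE_algebra
begin

lemma le_antisym:
  assumes "x \<in> A" "y \<in> A" "x \<rightarrow> y = \<one>" "y \<rightarrow> x = \<one>"
  shows "x = y"
  using comm_imp[of x y] assms by (simp add: one_rimp)

text \<open>If \<open>y \<le> z\<close>, commutativity rewrites \<open>z = (y \<rightarrow> z) \<leadsto> z\<close> as \<open>(z \<rightarrow> y) \<leadsto> y\<close>. So \<open>z\<close> has the form
  \<open>w \<leadsto> y\<close>, and \<open>x \<rightarrow> (w \<leadsto> y) = w \<leadsto> (x \<rightarrow> y)\<close> by exchange.\<close>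

lemma le_trans:
  assumes "x \<in> A" "y \<in> A" "z \<in> A" "x \<rightarrow> y = \<one>" "y \<rightarrow> z = \<one>"
  shows "x \<rightarrow> z = \<one>"
proof -
  have "z = (z \<rightarrow> y) \<leadsto> y"
    using comm_imp[of y z] assms by (simp add: one_rimp)
  then have "x \<rightarrow> z = (z \<rightarrow> y) \<leadsto> (x \<rightarrow> y)"
    using assms exchange[of x "z \<rightarrow> y" y] by (simp add: imp_closed)
  then show ?thesis
    using assms by (simp add: rimp_one imp_closed)
qed

lemma imp_antitone:
  assumes "x \<in> A" "w \<in> A" "y \<in> A" "x \<rightarrow> w = \<one>"
  shows "(w \<rightarrow> y) \<rightarrow> (x \<rightarrow> y) = \<one>"
proof -
  have "x \<rightarrow> ((w \<rightarrow> y) \<leadsto> y) = \<one>"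
    using assms le_trans[of x w] by (simp add: le_imp_rimp imp_closed rimp_closed)
  then show ?thesis
    using assms by (simp add: le_rimp_iff_le_imp imp_closed)
qed

end


section \<open>Distributivity makes the two implications equal\<close>

locale distributive_commutative_pseudo_BE_algebra =
  distributive_pseudo_BE_algebra + commutative_pseudo_BE_algebra
begin

text \<open>Distributivity gives \<open>x \<rightarrow> (x \<leadsto> z) = x \<rightarrow> z\<close>, hence \<open>x \<leadsto> z \<le> x \<rightarrow> z\<close>. For the converse let
  \<open>a = x \<rightarrow> z\<close>; by the Galois connection \<open>a \<le> x \<leadsto> z\<close> means \<open>x \<le> a \<rightarrow> z\<close>. Now \<open>x \<le> a \<leadsto> z\<close> always
  holds, and \<open>a \<leadsto> z \<le> a \<rightarrow> z\<close> is the inequality just shown, applied to \<open>a\<close> and \<open>z\<close>.\<close>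

lemma rimp_le_imp:
  assumes "x \<in> A" "z \<in> A"
  shows "(x \<leadsto> z) \<rightarrow> (x \<rightarrow> z) = \<one>"
proof -
  have "x \<rightarrow> (x \<leadsto> z) = x \<rightarrow> z"
    using assms distrib[of x x z] by (simp add: imp_self one_rimp imp_closed)
  then show ?thesis
    using assms le_imp[of x "x \<leadsto> z"] by (simp add: rimp_closed)
qed

lemma rimp_eq_imp:
  assumes "x \<in> A" "z \<in> A"
  shows "x \<leadsto> z = x \<rightarrow> z"
proof (rule le_antisym)
  have "x \<rightarrow> ((x \<rightarrow> z) \<rightarrow> z) = \<one>"
    using assms le_trans[of x "(x \<rightarrow> z) \<leadsto> z"]
    by (simp add: le_imp_rimp rimp_le_imp imp_closed rimp_closed)
  then show "(x \<rightarrow> z) \<rightarrow> (x \<leadsto> z) = \<one>"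
    using assms by (simp add: le_rimp_iff_le_imp imp_closed)
qed (use assms in \<open>simp_all add: rimp_le_imp imp_closed rimp_closed\<close>)

lemma imp_left_commute:
  assumes "x \<in> A" "y \<in> A" "z \<in> A"
  shows "x \<rightarrow> (y \<rightarrow> z) = y \<rightarrow> (x \<rightarrow> z)"
  using assms exchange[of x y z] by (simp add: rimp_eq_imp imp_closed)

lemma imp_distrib:
  assumes "x \<in> A" "y \<in> A" "z \<in> A"
  shows "x \<rightarrow> (y \<rightarrow> z) = (x \<rightarrow> y) \<rightarrow> (x \<rightarrow> z)"
  using assms distrib[of x y z] by (simp add: rimp_eq_imp imp_closed)

lemma imp_trans_right:
  assumes "x \<in> A" "u \<in> A" "v \<in> A"
  shows "(u \<rightarrow> v) \<rightarrow> ((x \<rightarrow> u) \<rightarrow> (x \<rightarrow> v)) = \<one>"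
  using assms le_imp[of x "u \<rightarrow> v"] by (simp add: imp_distrib[symmetric] imp_closed)

lemma imp_trans_left:
  assumes "x \<in> A" "y \<in> A" "u \<in> A"
  shows "(x \<rightarrow> y) \<rightarrow> ((y \<rightarrow> u) \<rightarrow> (x \<rightarrow> u)) = \<one>"
  using assms imp_trans_right[of x y u]
  by (simp add: imp_left_commute[of "x \<rightarrow> y" "y \<rightarrow> u" "x \<rightarrow> u"] imp_closed)

end


section \<open>The congruence of a deductive system\<close>

definition ds_congruence :: "'a set \<Rightarrow> ('a \<Rightarrow> 'a \<Rightarrow> 'a) \<Rightarrow> 'a set \<Rightarrow> 'a rel" where
  "ds_congruence A imp D = {(x, y). x \<in> A \<and> y \<in> A \<and> imp x y \<in> D \<and> imp y x \<in> D}"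

lemma deductive_system_mp:
  assumes "deductive_system A imp one D" "x \<in> D" "imp x y \<in> D" "y \<in> A"
  shows "y \<in> D"
  using assms unfolding deductive_system_def by blast

context pseudo_BE_algebra
begin

lemma deductive_system_upward_closed:
  assumes "deductive_system A (\<rightarrow>) \<one> D" "x \<in> D" "x \<rightarrow> y = \<one>" "y \<in> A"
  shows "y \<in> D"
  using assms unfolding deductive_system_def by auto

lemma class_one_ds_congruence:
  assumes "deductive_system A (\<rightarrow>) \<one> D"
  shows "ds_congruence A (\<rightarrow>) D `` {\<one>} = D"
  using assms unfolding ds_congruence_def deductive_system_def
  by (auto simp: one_imp imp_one one_closed subset_iff)

end

context distributive_commutative_pseudo_BE_algebra
begin

context
  fixes D
  assumes D: "deductive_system A (\<rightarrow>) \<one> D"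
begin

lemma deductive_system_trans:
  assumes "x \<in> A" "y \<in> A" "z \<in> A" "x \<rightarrow> y \<in> D" "y \<rightarrow> z \<in> D"
  shows "x \<rightarrow> z \<in> D"
proof -
  have "(y \<rightarrow> z) \<rightarrow> (x \<rightarrow> z) \<in> D"
    using assms deductive_system_upward_closed[OF D, of "x \<rightarrow> y"]
    by (simp add: imp_trans_left imp_closed)
  then show ?thesis
    using assms deductive_system_mp[OF D, of "y \<rightarrow> z" "x \<rightarrow> z"] by (simp add: imp_closed)
qed

lemma equiv_ds_congruence: "equiv A (ds_congruence A (\<rightarrow>) D)"
proof (rule equivI)
  show "refl_on A (ds_congruence A (\<rightarrow>) D)"
    using D by (auto simp: refl_on_def ds_congruence_def deductive_system_def imp_self)
  show "trans (ds_congruence A (\<rightarrow>) D)"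
  proof (rule transI)
    fix x y z
    assume "(x, y) \<in> ds_congruence A (\<rightarrow>) D" "(y, z) \<in> ds_congruence A (\<rightarrow>) D"
    then show "(x, z) \<in> ds_congruence A (\<rightarrow>) D"
      using deductive_system_trans[of x y z] deductive_system_trans[of z y x]
      by (simp add: ds_congruence_def)
  qed
qed (auto simp: sym_def ds_congruence_def)

text \<open>Passing from \<open>x \<rightarrow> u\<close> to \<open>y \<rightarrow> v\<close> through \<open>y \<rightarrow> u\<close> changes one argument at a time, so that each
  step is a transitivity law for \<open>\<rightarrow>\<close>.\<close>

lemma deductive_system_imp_mono:
  assumes "x \<in> A" "y \<in> A" "u \<in> A" "v \<in> A" "y \<rightarrow> x \<in> D" "u \<rightarrow> v \<in> D"
  shows "(x \<rightarrow> u) \<rightarrow> (y \<rightarrow> v) \<in> D"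
proof (rule deductive_system_trans[of _ "y \<rightarrow> u"])
  show "(x \<rightarrow> u) \<rightarrow> (y \<rightarrow> u) \<in> D"
    using assms deductive_system_upward_closed[OF D, of "y \<rightarrow> x"]
    by (simp add: imp_trans_left imp_closed)
  show "(y \<rightarrow> u) \<rightarrow> (y \<rightarrow> v) \<in> D"
    using assms deductive_system_upward_closed[OF D, of "u \<rightarrow> v"]
    by (simp add: imp_trans_right imp_closed)
qed (use assms in \<open>simp_all add: imp_closed\<close>)

lemma congruence_ds_congruence: "congruence A (\<rightarrow>) (\<leadsto>) (ds_congruence A (\<rightarrow>) D)"
  unfolding congruence_def
  using equiv_ds_congruence
  by (auto simp: ds_congruence_def rimp_eq_imp imp_closed intro: deductive_system_imp_mono)

end

end


section \<open>The class of the unit\<close>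

context pseudo_BE_algebra
begin

lemma deductive_system_class_one:
  assumes "congruence A (\<rightarrow>) (\<leadsto>) \<Theta>"
  shows "deductive_system A (\<rightarrow>) \<one> (\<Theta> `` {\<one>})"
proof -
  have eq: "equiv A \<Theta>"
    using assms by (simp add: congruence_def)
  have "y \<in> \<Theta> `` {\<one>}"
    if "x \<in> A" "y \<in> A" "x \<in> \<Theta> `` {\<one>}" "x \<rightarrow> y \<in> \<Theta> `` {\<one>}" for x y
  proof -
    have "(y, y) \<in> \<Theta>"
      using eq \<open>y \<in> A\<close> by (meson equiv_def refl_on_def)
    then have "(\<one> \<rightarrow> y, x \<rightarrow> y) \<in> \<Theta>"
      using assms that unfolding congruence_def by blast
    then have "(y, x \<rightarrow> y) \<in> \<Theta>"
      using \<open>y \<in> A\<close> by (simp add: one_imp)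
    moreover have "(\<one>, x \<rightarrow> y) \<in> \<Theta>"
      using that by blast
    ultimately show ?thesis
      using eq by (meson Image_singleton_iff equiv_def symD transD)
  qed
  moreover have "\<Theta> `` {\<one>} \<subseteq> A" "\<one> \<in> \<Theta> `` {\<one>}"
    using eq one_closed by (auto simp: equiv_def refl_on_def)
  ultimately show ?thesis
    unfolding deductive_system_def by blast
qed

end

text \<open>The term \<open>(x \<rightarrow> y) \<leadsto> y\<close> reduces to \<open>y\<close> when \<open>x \<rightarrow> y\<close> is replaced by \<open>\<one>\<close>; commutativity makes
  it symmetric in \<open>x\<close> and \<open>y\<close>, so it also reduces to \<open>x\<close> when \<open>y \<rightarrow> x\<close> is replaced by \<open>\<one>\<close>.\<close>

lemma (in commutative_pseudo_BE_algebra) ds_congruence_class_one: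
  assumes "congruence A (\<rightarrow>) (\<leadsto>) \<Theta>"
  shows "ds_congruence A (\<rightarrow>) (\<Theta> `` {\<one>}) = \<Theta>"
proof -
  have eq: "equiv A \<Theta>"
    using assms by (simp add: congruence_def)
  have imp_cong: "(x \<rightarrow> u, y \<rightarrow> v) \<in> \<Theta>" and rimp_cong: "(x \<leadsto> u, y \<leadsto> v) \<in> \<Theta>"
    if "(x, y) \<in> \<Theta>" "(u, v) \<in> \<Theta>" for x y u v
    using assms that unfolding congruence_def by blast+
  have refl: "(x, x) \<in> \<Theta>" if "x \<in> A" for x
    using eq that by (meson equiv_def refl_on_def)
  have sym: "(y, x) \<in> \<Theta>" if "(x, y) \<in> \<Theta>" for x y
    using eq that by (meson equiv_def symD)
  have trans: "(x, z) \<in> \<Theta>" if "(x, y) \<in> \<Theta>" "(y, z) \<in> \<Theta>" for x y z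
    using eq that by (meson equiv_def transD)
  have carrier: "x \<in> A" "y \<in> A" if "(x, y) \<in> \<Theta>" for x y
    using eq that by (auto dest: equiv_type)
  have imp_one_class: "(\<one>, x \<rightarrow> y) \<in> \<Theta>" if "(x, y) \<in> \<Theta>" for x y
    using imp_cong[OF refl that] carrier[OF that] by (metis imp_self)
  have join_class: "(y, (x \<rightarrow> y) \<leadsto> y) \<in> \<Theta>" if "y \<in> A" "(\<one>, x \<rightarrow> y) \<in> \<Theta>" for x y
    using rimp_cong[OF that(2) refl[OF that(1)]] that(1) by (simp add: one_rimp)
  have "(x, y) \<in> \<Theta>" if "x \<in> A" "y \<in> A" "(\<one>, x \<rightarrow> y) \<in> \<Theta>" "(\<one>, y \<rightarrow> x) \<in> \<Theta>" for x y
    using join_class[of y x] join_class[of x y] comm_imp[of x y] that sym trans by metis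
  then show ?thesis
    unfolding ds_congruence_def using carrier imp_one_class sym by blast
qed


section \<open>Monadic congruences and monadic deductive systems\<close>

context monadic_pseudo_BE_algebra
begin

lemma U_one: "U \<one> = \<one>"
  using M3_imp[of \<one> \<one>] one_closed by (simp add: M1_imp imp_self E_closed)

text \<open>\<open>U x\<close> is a fixed point of \<open>E\<close>, so (M4) lets it pass through \<open>U\<close> as the antecedent.\<close>

lemma U_imp_U:
  assumes "x \<in> A" "y \<in> A"
  shows "U (U x \<rightarrow> y) = U x \<rightarrow> U y"
  using assms M4_imp[of "U x" y] by (simp add: M5 U_closed)

end

sublocale monadic_distributive_commutative_pseudo_BE_algebra \<subseteq>
  distributive_commutative_pseudo_BE_algebra ..

context monadic_distributive_commutative_pseudo_BE_algebra
begin

text \<open>Since \<open>U x \<le> x\<close>, replacing \<open>x\<close> by \<open>U x\<close> only enlarges \<open>x \<rightarrow> y\<close>.\<close>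

lemma monadic_deductive_system_U_imp_U:
  assumes "D \<in> monadic_deductive_systems A (\<rightarrow>) \<one> U" "x \<in> A" "y \<in> A" "x \<rightarrow> y \<in> D"
  shows "U x \<rightarrow> U y \<in> D"
proof -
  have D: "deductive_system A (\<rightarrow>) \<one> D" and U: "\<And>x. x \<in> D \<Longrightarrow> U x \<in> D"
    using assms by (auto simp: monadic_deductive_systems_def)
  have "U x \<rightarrow> y \<in> D"
    using assms deductive_system_upward_closed[OF D, of "x \<rightarrow> y"]
    by (simp add: imp_antitone M2_imp U_closed imp_closed)
  then show ?thesis
    using U U_imp_U assms by metis
qed

lemma ds_congruence_monadic:
  assumes "D \<in> monadic_deductive_systems A (\<rightarrow>) \<one> U"
  shows "ds_congruence A (\<rightarrow>) D \<in> monadic_congruences A (\<rightarrow>) (\<leadsto>) U"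
proof -
  have "congruence A (\<rightarrow>) (\<leadsto>) (ds_congruence A (\<rightarrow>) D)"
    using assms congruence_ds_congruence by (simp add: monadic_deductive_systems_def)
  then show ?thesis
    using monadic_deductive_system_U_imp_U[OF assms]
    by (auto simp: monadic_congruences_def ds_congruence_def U_closed)
qed

lemma class_one_monadic:
  assumes "\<Theta> \<in> monadic_congruences A (\<rightarrow>) (\<leadsto>) U"
  shows "\<Theta> `` {\<one>} \<in> monadic_deductive_systems A (\<rightarrow>) \<one> U"
proof -
  have "(\<one>, U x) \<in> \<Theta>" if "(\<one>, x) \<in> \<Theta>" for x
    using assms that U_one unfolding monadic_congruences_def by fastforce
  then show ?thesis
    using assms deductive_system_class_one
    by (auto simp: monadic_congruences_def monadic_deductive_systems_def)
qed

lemma bij_betw_class_one: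
  "bij_betw (\<lambda>\<Theta>. \<Theta> `` {\<one>})
     (monadic_congruences A (\<rightarrow>) (\<leadsto>) U) (monadic_deductive_systems A (\<rightarrow>) \<one> U)"
proof (rule bij_betw_byWitness[where f' = "ds_congruence A (\<rightarrow>)"])
  show "\<forall>\<Theta> \<in> monadic_congruences A (\<rightarrow>) (\<leadsto>) U. ds_congruence A (\<rightarrow>) (\<Theta> `` {\<one>}) = \<Theta>"
    by (simp add: monadic_congruences_def ds_congruence_class_one)
  show "\<forall>D \<in> monadic_deductive_systems A (\<rightarrow>) \<one> U. ds_congruence A (\<rightarrow>) D `` {\<one>} = D"
    by (simp add: monadic_deductive_systems_def class_one_ds_congruence)
qed (use class_one_monadic ds_congruence_monadic in blast)+

end

theorem theorem6p11:
  fixes A :: "'a set"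
    and imp rimp :: "'a \<Rightarrow> 'a \<Rightarrow> 'a"
    and one :: 'a
    and E U :: "'a \<Rightarrow> 'a"
  assumes "monadic_distributive_commutative_pseudo_BE_algebra A imp rimp one E U"
  shows "\<exists>f. bij_betw f (monadic_congruences A imp rimp U) (monadic_deductive_systems A imp one U)"
proof -
  interpret monadic_distributive_commutative_pseudo_BE_algebra A imp rimp one E U
    by (rule assms)
  show ?thesis
    using bij_betw_class_one by blast
qed

end
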